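(* The scheme HE does not imply the scheme DP in intuitionistic logic: there is a formula $Px$ such that the instance $\exists y\,(Py\to\forall x\,Px)$ of DP is not derivable in intuitionistic first-order logic extended by all instances of HE.
   Context: Fix a first-order language (without equality) with countably many relation symbols of each arity. Schemata, for arbitrary formulas $Px$ (possibly with further free variables), with $Py$ denoting $Px$ with the fresh variable $y$ substituted for $x$: $\mathrm{DP}(Px) := \exists y\,(Py \to \forall x\, Px)$ (Drinker Paradox) and $\mathrm{HE}(Px) := \exists y\,(\exists x\, Px \to Py)$ (schematic form of Hilbert's Epsilon). Extending a logic by a scheme means adding, for every formula instance of the scheme (possibly with free variables), a premise-free natural deduction rule concluding that instance; $\forall$-introduction may be applied to free variables of such instances. *)

theory Defs
  imports Main
begin

text \<open>
  Purely relational first-order language without equality, in de Bruijn notation; the only terms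
  are variables. The atom \<open>Rel k xs\<close> applies the \<open>k\<close>-th relation symbol of arity \<open>length xs\<close>, so
  \<open>Rel k xs\<close> and \<open>Rel k ys\<close> carry different symbols when the lengths differ.
\<close>

datatype fm =
    Rel nat "nat list"
  | Falsum                 ("\<^bold>\<bottom>")
  | Conj fm fm             (infixr "\<^bold>\<and>" 35)
  | Disj fm fm             (infixr "\<^bold>\<or>" 30)
  | Imp fm fm              (infixr "\<^bold>\<longrightarrow>" 25)
  | Forall fm              ("\<^bold>\<forall> _" [40] 40)
  | Exists fm              ("\<^bold>\<exists> _" [40] 40)

text \<open>Since all terms are variables, capture-avoiding substitution is renaming.\<close>

definition under :: "(nat \<Rightarrow> nat) \<Rightarrow> nat \<Rightarrow> nat" where
  "under f = case_nat 0 (\<lambda>n. Suc (f n))"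

primrec rename :: "(nat \<Rightarrow> nat) \<Rightarrow> fm \<Rightarrow> fm" where
  "rename f (Rel k xs) = Rel k (map f xs)"
| "rename f \<^bold>\<bottom> = \<^bold>\<bottom>"
| "rename f (A \<^bold>\<and> B) = (rename f A \<^bold>\<and> rename f B)"
| "rename f (A \<^bold>\<or> B) = (rename f A \<^bold>\<or> rename f B)"
| "rename f (A \<^bold>\<longrightarrow> B) = (rename f A \<^bold>\<longrightarrow> rename f B)"
| "rename f (\<^bold>\<forall> A) = (\<^bold>\<forall> (rename (under f) A))"
| "rename f (\<^bold>\<exists> A) = (\<^bold>\<exists> (rename (under f) A))"

text \<open>\<open>shift A\<close> is \<open>A\<close> read in a scope with one more variable, which is fresh for it and has index \<open>0\<close>.\<close>

definition shift :: "fm \<Rightarrow> fm" where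
  "shift = rename Suc"

text \<open>\<open>inst y A\<close> removes variable \<open>0\<close> from the scope of \<open>A\<close>, replacing it by the variable \<open>y\<close>.\<close>

definition inst :: "nat \<Rightarrow> fm \<Rightarrow> fm" where
  "inst y = rename (case_nat y id)"

text \<open>
  Intuitionistic natural deduction, extended by a premise-free rule for each formula in \<open>Ax\<close>.
  The eigenvariable condition in \<open>ForallI\<close> and \<open>ExistsE\<close> restricts only the open assumptions, by
  shifting them; variables of formulas from \<open>Ax\<close> may be generalized.
\<close>

inductive deriv :: "fm set \<Rightarrow> fm list \<Rightarrow> fm \<Rightarrow> bool" ("_; _ \<turnstile> _" [50, 50, 50] 50)
  for Ax :: "fm set" where
  Axiom: "A \<in> Ax \<Longrightarrow> Ax; G \<turnstile> A"
| Assm: "A \<in> set G \<Longrightarrow> Ax; G \<turnstile> A"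
| FalsumE: "Ax; G \<turnstile> \<^bold>\<bottom> \<Longrightarrow> Ax; G \<turnstile> A"
| ConjI: "Ax; G \<turnstile> A \<Longrightarrow> Ax; G \<turnstile> B \<Longrightarrow> Ax; G \<turnstile> (A \<^bold>\<and> B)"
| ConjE1: "Ax; G \<turnstile> (A \<^bold>\<and> B) \<Longrightarrow> Ax; G \<turnstile> A"
| ConjE2: "Ax; G \<turnstile> (A \<^bold>\<and> B) \<Longrightarrow> Ax; G \<turnstile> B"
| DisjI1: "Ax; G \<turnstile> A \<Longrightarrow> Ax; G \<turnstile> (A \<^bold>\<or> B)"
| DisjI2: "Ax; G \<turnstile> B \<Longrightarrow> Ax; G \<turnstile> (A \<^bold>\<or> B)"
| DisjE: "Ax; G \<turnstile> (A \<^bold>\<or> B) \<Longrightarrow> Ax; A # G \<turnstile> C \<Longrightarrow> Ax; B # G \<turnstile> C \<Longrightarrow> Ax; G \<turnstile> C"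
| ImpI: "Ax; A # G \<turnstile> B \<Longrightarrow> Ax; G \<turnstile> (A \<^bold>\<longrightarrow> B)"
| ImpE: "Ax; G \<turnstile> (A \<^bold>\<longrightarrow> B) \<Longrightarrow> Ax; G \<turnstile> A \<Longrightarrow> Ax; G \<turnstile> B"
| ForallI: "Ax; map shift G \<turnstile> A \<Longrightarrow> Ax; G \<turnstile> (\<^bold>\<forall> A)"
| ForallE: "Ax; G \<turnstile> (\<^bold>\<forall> A) \<Longrightarrow> Ax; G \<turnstile> inst y A"
| ExistsI: "Ax; G \<turnstile> inst y A \<Longrightarrow> Ax; G \<turnstile> (\<^bold>\<exists> A)"
| ExistsE: "Ax; G \<turnstile> (\<^bold>\<exists> A) \<Longrightarrow> Ax; A # map shift G \<turnstile> shift C \<Longrightarrow> Ax; G \<turnstile> C"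

text \<open>
  In both schemata, \<open>P\<close> has the distinguished variable \<open>x\<close> at index \<open>0\<close>; its other free variables
  are parameters. Under the quantifier for \<open>y\<close>, index \<open>0\<close> denotes \<open>y\<close>, so there \<open>P\<close> itself is
  \<open>Py\<close>, while the closed-off subformula in \<open>x\<close> has to be shifted past \<open>y\<close>.
\<close>

definition DP :: "fm \<Rightarrow> fm" where
  "DP P = (\<^bold>\<exists> (P \<^bold>\<longrightarrow> shift (\<^bold>\<forall> P)))"

definition HE :: "fm \<Rightarrow> fm" where
  "HE P = (\<^bold>\<exists> (shift (\<^bold>\<exists> P) \<^bold>\<longrightarrow> P))"

end

theory Submission
  imports Defs
begin

text \<open>
  The countermodel is a Kripke model with constant domain \<open>nat\<close> whose worlds are the natural
  numbers in their usual order. Its truth values, the up-closed sets of worlds, are the sets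
  \<open>{n..}\<close> and the empty set. Under inclusion they form a chain in which every nonempty family
  has a greatest member, but some families have no least one.

  An instance of \<open>HE\<close> says that the supremum of the truth values of \<open>Px\<close> is attained by some \<open>x\<close>.
  This always holds here: a nonempty set of worlds has a first element, and a witness of \<open>\<exists>x Px\<close>
  at the first world forcing \<open>\<exists>x Px\<close> still works at all later worlds, by monotonicity
  (\<open>forces_HE\<close>). An instance of \<open>DP\<close> asks instead for some \<open>y\<close> such that \<open>Py\<close> becomes true no
  earlier than \<open>\<forall>x Px\<close> does. If \<open>Px\<close> is an atom true of \<open>x\<close> exactly from world \<open>x\<close> on, then
  every \<open>Py\<close> becomes true at some world but \<open>\<forall>x Px\<close> never does, so the instance is forced nowhere
  (\<open>not_forces_DP\<close>). As the rules of intuitionistic logic preserve forcing (\<open>soundness\<close>), this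
  instance of \<open>DP\<close> is not derivable from \<open>HE\<close>.
\<close>

text \<open>
  The clause for atoms makes a unary atom hold of \<open>x\<close> from world \<open>x\<close> on. For other arities, any
  interpretation that persists to later worlds would do.
\<close>

primrec forces :: "nat \<Rightarrow> (nat \<Rightarrow> nat) \<Rightarrow> fm \<Rightarrow> bool" where
  "forces w e (Rel k xs) \<longleftrightarrow> (\<forall>x \<in> set xs. e x \<le> w)"
| "forces w e \<^bold>\<bottom> \<longleftrightarrow> False"
| "forces w e (A \<^bold>\<and> B) \<longleftrightarrow> forces w e A \<and> forces w e B"
| "forces w e (A \<^bold>\<or> B) \<longleftrightarrow> forces w e A \<or> forces w e B"
| "forces w e (A \<^bold>\<longrightarrow> B) \<longleftrightarrow> (\<forall>v\<ge>w. forces v e A \<longrightarrow> forces v e B)"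
| "forces w e (\<^bold>\<forall> A) \<longleftrightarrow> (\<forall>d. forces w (case_nat d e) A)"
| "forces w e (\<^bold>\<exists> A) \<longleftrightarrow> (\<exists>d. forces w (case_nat d e) A)"

lemma forces_mono: "forces w e A \<Longrightarrow> w \<le> v \<Longrightarrow> forces v e A"
proof (induction A arbitrary: w v e)
  case (Rel k xs)
  then show ?case by (auto intro: order_trans)
next
  case (Imp A B)
  then show ?case by (auto intro: order_trans)
next
  case (Forall A)
  then show ?case by simp blast
next
  case (Exists A)
  then show ?case by simp blast
qed auto

lemma case_nat_under: "case_nat d e \<circ> under f = case_nat d (e \<circ> f)"
  by (rule ext) (simp add: under_def split: nat.split)

lemma forces_rename: "forces w e (rename f A) \<longleftrightarrow> forces w (e \<circ> f) A"
  by (induction A arbitrary: w e f) (simp_all add: case_nat_under)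

lemma forces_shift: "forces w (case_nat d e) (shift A) \<longleftrightarrow> forces w e A"
  by (simp add: shift_def forces_rename comp_def)

lemma forces_inst: "forces w e (inst y A) \<longleftrightarrow> forces w (case_nat (e y) e) A"
proof -
  have "e \<circ> case_nat y id = case_nat (e y) e"
    by (rule ext) (simp split: nat.split)
  then show ?thesis by (simp add: inst_def forces_rename)
qed

text \<open>
  Axioms have to be forced under all assignments, since \<open>ForallI\<close> may generalize their free
  variables.
\<close>

lemma soundness:
  assumes "Ax; G \<turnstile> A"
    and Ax: "\<And>B w e. B \<in> Ax \<Longrightarrow> forces w e B"
    and "\<forall>B \<in> set G. forces w e B"
  shows "forces w e A"
  using assms(1,3)
proof (induction arbitrary: w e rule: deriv.induct)
  case (Axiom A G)
  then show ?case by (simp add: Ax)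
next
  case (DisjE G A B C)
  from DisjE.IH(1) DisjE.prems have "forces w e A \<or> forces w e B" by simp
  with DisjE.IH(2,3)[of w e] DisjE.prems show ?case by auto
next
  case (ImpI A G B)
  have "forces v e B" if "w \<le> v" "forces v e A" for v
    using ImpI.IH[of v e] ImpI.prems that by (simp add: forces_mono[OF _ that(1)])
  then show ?case by simp
next
  case (ImpE G A B)
  then show ?case by auto
next
  case (ForallI G A)
  then show ?case by (simp add: forces_shift)
next
  case (ForallE G A y)
  then show ?case by (simp add: forces_inst)
next
  case (ExistsI G y A)
  then show ?case by (auto simp: forces_inst)
next
  case (ExistsE G A C)
  then obtain d where "forces w (case_nat d e) A" by fastforce
  with ExistsE.IH(2)[of w "case_nat d e"] ExistsE.prems
  have "forces w (case_nat d e) (shift C)" by (simp add: forces_shift)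
  then show ?case by (simp add: forces_shift)
qed auto

text \<open>
  The witness of \<open>\<exists>y\<close> in \<open>HE P\<close> has to be chosen at \<open>w\<close>, before it is known at which world
  \<open>\<exists>x Px\<close> becomes true. Looking ahead is possible because the domain is constant and the worlds
  are well-ordered.
\<close>

lemma forces_HE: "forces w e (HE P)"
proof (cases "\<exists>v\<ge>w. forces v e (\<^bold>\<exists> P)")
  case True
  define v where "v = (LEAST v. w \<le> v \<and> forces v e (\<^bold>\<exists> P))"
  have "forces v e (\<^bold>\<exists> P)"
    using LeastI_ex[OF True] by (simp add: v_def)
  then obtain d where d: "forces v (case_nat d e) P" by auto
  have "forces u (case_nat d e) P" if "w \<le> u" "forces u e (\<^bold>\<exists> P)" for u
  proof -
    have "v \<le> u" unfolding v_def using that by (intro Least_le) blast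
    with d show ?thesis by (rule forces_mono)
  qed
  then show ?thesis
    unfolding HE_def by (auto simp only: forces.simps forces_shift)
next
  case False
  then show ?thesis
    unfolding HE_def by (auto simp only: forces.simps forces_shift)
qed

lemma not_forces_DP: "\<not> forces w e (DP (Rel k [0]))"
proof
  assume "forces w e (DP (Rel k [0]))"
  then obtain d where d: "\<forall>v\<ge>w. d \<le> v \<longrightarrow> (\<forall>x. x \<le> v)"
    unfolding DP_def by (auto simp only: forces.simps forces_shift) simp
  \<comment> \<open>At world \<open>max w d\<close> the atom holds of \<open>d\<close>, but not yet of the next number.\<close>
  from d have "Suc (max w d) \<le> max w d" using max.cobounded1 max.cobounded2 by blast
  then show False by simp
qed

theorem proposition5:
  "\<exists>P. \<not> (range HE; [] \<turnstile> DP P)"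
proof
  show "\<not> (range HE; [] \<turnstile> DP (Rel 0 [0]))"
  proof
    assume "range HE; [] \<turnstile> DP (Rel 0 [0])"
    then have "forces 0 id (DP (Rel 0 [0]))"
      by (rule soundness) (auto intro: forces_HE)
    then show False by (simp add: not_forces_DP)
  qed
qed

end
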